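(* There exists a properly immersed translating solution to the curve diffusion flow in the plane $\mathbb{R}^2$ whose curvature is nonconstant.
   Context: Let $M$ be a one-dimensional manifold and $I$ an interval. A map $X: M\times I\to\mathbb{R}^2$ (a family of immersed curves $X(\cdot,t)$) is a solution to the curve diffusion flow if $$\left(\frac{dX}{dt}\right)^{\perp}=-\kappa_{ss}N,$$ where $\perp$ denotes the component normal to the curve, $s$ is the arc length parameter of the curve $X(\cdot,t)$, $\kappa=\theta_s$ is the curvature, $\theta$ being the angle that the oriented unit tangent vector $T=(\cos\theta,\sin\theta)$ makes with the $x$-axis, and $N=JT=(-\sin\theta,\cos\theta)$ is the unit normal ($J$ is the rotation by $\pi/2$, i.e. multiplication by $i$). A translating solution is a solution for which $\frac{dX}{dt}=\vec E$ for some fixed unit vector $\vec E\in\mathbb{R}^2$, i.e. $X(\omega,t)=\gamma(\omega)+t\vec E$ for a fixed profile curve $\gamma: M\to\mathbb{R}^2$; equivalently the profile satisfies $\vec E\cdot N=-\kappa_{ss}$. It is properly immersed if $\gamma$ is an immersion and a proper map (preimages of compact sets are compact). *)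

theory Defs
  imports "HOL-Analysis.Analysis"
begin

section \<open>Oriented smooth one-dimensional manifolds\<close>

text \<open>
  To be used for open \<open>S\<close>: \<open>F k\<close> is the \<open>k\<close>-th derivative of \<open>f\<close> on \<open>S\<close>.
\<close>

definition smooth_on :: "real set \<Rightarrow> (real \<Rightarrow> 'b::real_normed_vector) \<Rightarrow> bool" where
  "smooth_on S f \<longleftrightarrow>
     (\<exists>F :: nat \<Rightarrow> real \<Rightarrow> 'b.
        (\<forall>x\<in>S. F 0 x = f x) \<and>
        (\<forall>k. \<forall>x\<in>S. (F k has_vector_derivative F (Suc k) x) (at x)))"

text \<open>A chart is a pair \<open>(U, \<phi>)\<close> of a coordinate domain and a coordinate on it.\<close>

type_synonym 'm chart = "'m set \<times> ('m \<Rightarrow> real)"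

definition local_rep :: "'m chart \<Rightarrow> ('m \<Rightarrow> 'b) \<Rightarrow> real \<Rightarrow> 'b" where
  "local_rep c f = f \<circ> inv_into (fst c) (snd c)"

text \<open>
  Manifolds have no boundary and need not be connected. The atlas is oriented (transition maps
  are increasing), since the unit tangent vector and the sign of the curvature depend on an
  orientation; every one-dimensional manifold is orientable.
\<close>

definition oriented_1_manifold :: "'m topology \<Rightarrow> 'm chart set \<Rightarrow> bool" where
  "oriented_1_manifold M A \<longleftrightarrow>
     Hausdorff_space M \<and> second_countable M \<and>
     (\<Union>(U, \<phi>)\<in>A. U) = topspace M \<and>
     (\<forall>(U, \<phi>)\<in>A. openin M U \<and> open (\<phi> ` U) \<and>
        homeomorphic_map (subtopology M U) (top_of_set (\<phi> ` U)) \<phi>) \<and>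
     (\<forall>(U, \<phi>)\<in>A. \<forall>(V, \<psi>)\<in>A.
        smooth_on (\<phi> ` (U \<inter> V)) (local_rep (U, \<phi>) \<psi>) \<and>
        (\<forall>x\<in>\<phi> ` (U \<inter> V). deriv (local_rep (U, \<phi>) \<psi>) x > 0))"

definition chart_deriv ::
  "'m chart \<Rightarrow> ('m \<Rightarrow> 'b::real_normed_vector) \<Rightarrow> 'm \<Rightarrow> 'b" where
  "chart_deriv c f p = vector_derivative (local_rep c f) (at (snd c p))"

definition immersion :: "'m chart set \<Rightarrow> ('m \<Rightarrow> real^2) \<Rightarrow> bool" where
  "immersion A \<gamma> \<longleftrightarrow>
     (\<forall>c\<in>A. smooth_on (snd c ` fst c) (local_rep c \<gamma>) \<and>
             (\<forall>p\<in>fst c. chart_deriv c \<gamma> p \<noteq> 0))"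

section \<open>Geometry of immersed plane curves\<close>

text \<open>
  The derivative of \<open>f\<close> at \<open>p\<close> with respect to the arc length \<open>s\<close> of \<open>\<gamma>\<close>: in a coordinate \<open>u\<close>,
  \<open>d/ds = |\<gamma>\<^sub>u|\<^sup>-\<^sup>1 d/du\<close>. As the transition maps are smooth and increasing, the value does not
  depend on which chart around \<open>p\<close> is chosen.
\<close>

definition arc_deriv ::
  "'m chart set \<Rightarrow> ('m \<Rightarrow> real^2) \<Rightarrow> ('m \<Rightarrow> 'b::real_normed_vector) \<Rightarrow> 'm \<Rightarrow> 'b" where
  "arc_deriv A \<gamma> f p =
     (let c = (SOME c. c \<in> A \<and> p \<in> fst c)
      in chart_deriv c f p /\<^sub>R norm (chart_deriv c \<gamma> p))"

definition unit_tangent :: "'m chart set \<Rightarrow> ('m \<Rightarrow> real^2) \<Rightarrow> 'm \<Rightarrow> real^2" where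
  "unit_tangent A \<gamma> p = arc_deriv A \<gamma> \<gamma> p"

definition rot90 :: "real^2 \<Rightarrow> real^2" where
  "rot90 v = vector [- (v $ 2), v $ 1]"

definition unit_normal :: "'m chart set \<Rightarrow> ('m \<Rightarrow> real^2) \<Rightarrow> 'm \<Rightarrow> real^2" where
  "unit_normal A \<gamma> p = rot90 (unit_tangent A \<gamma> p)"

definition tangent_angle_on ::
  "'m topology \<Rightarrow> 'm chart set \<Rightarrow> ('m \<Rightarrow> real^2) \<Rightarrow> 'm set \<Rightarrow> ('m \<Rightarrow> real) \<Rightarrow> bool" where
  "tangent_angle_on M A \<gamma> U \<theta> \<longleftrightarrow>
     continuous_map (subtopology M U) euclideanreal \<theta> \<and>
     (\<forall>q\<in>U. unit_tangent A \<gamma> q = vector [cos (\<theta> q), sin (\<theta> q)])"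

text \<open>
  The tangent angle exists in general only locally (not, for instance, on a closed curve). Two
  continuous angles near \<open>p\<close> differ near \<open>p\<close> by a constant multiple of \<open>2\<pi>\<close>, so the curvature
  \<open>\<kappa> = \<theta>\<^sub>s\<close> of an immersion is well defined.
\<close>

definition curvature :: "'m topology \<Rightarrow> 'm chart set \<Rightarrow> ('m \<Rightarrow> real^2) \<Rightarrow> 'm \<Rightarrow> real" where
  "curvature M A \<gamma> p =
     (THE k. \<exists>U \<theta>. openin M U \<and> p \<in> U \<and> tangent_angle_on M A \<gamma> U \<theta> \<and>
        k = arc_deriv A \<gamma> \<theta> p)"

definition curvature_ss :: "'m topology \<Rightarrow> 'm chart set \<Rightarrow> ('m \<Rightarrow> real^2) \<Rightarrow> 'm \<Rightarrow> real" where
  "curvature_ss M A \<gamma> = arc_deriv A \<gamma> (arc_deriv A \<gamma> (curvature M A \<gamma>))"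

definition normal_component ::
  "'m chart set \<Rightarrow> ('m \<Rightarrow> real^2) \<Rightarrow> 'm \<Rightarrow> real^2 \<Rightarrow> real^2" where
  "normal_component A \<gamma> p v = (v \<bullet> unit_normal A \<gamma> p) *\<^sub>R unit_normal A \<gamma> p"

section \<open>Curve diffusion flow and translating solutions\<close>

text \<open>
  At an endpoint of the time interval \<open>I\<close> the time derivative is one-sided.
\<close>

definition curve_diffusion_flow ::
  "'m topology \<Rightarrow> 'm chart set \<Rightarrow> real set \<Rightarrow> ('m \<times> real \<Rightarrow> real^2) \<Rightarrow> bool" where
  "curve_diffusion_flow M A I X \<longleftrightarrow>
     oriented_1_manifold M A \<and> is_interval I \<and> interior I \<noteq> {} \<and>
     (\<forall>t\<in>I. immersion A (\<lambda>p. X (p, t))) \<and>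
     (\<forall>p\<in>topspace M. \<forall>t\<in>I. \<exists>V.
        ((\<lambda>\<tau>. X (p, \<tau>)) has_vector_derivative V) (at t within I) \<and>
        normal_component A (\<lambda>q. X (q, t)) p V =
          - curvature_ss M A (\<lambda>q. X (q, t)) p *\<^sub>R unit_normal A (\<lambda>q. X (q, t)) p)"

definition translating_solution ::
  "'m topology \<Rightarrow> 'm chart set \<Rightarrow> real set \<Rightarrow> ('m \<times> real \<Rightarrow> real^2) \<Rightarrow> real^2 \<Rightarrow> ('m \<Rightarrow> real^2) \<Rightarrow> bool"
  where
  "translating_solution M A I X E \<gamma> \<longleftrightarrow>
     curve_diffusion_flow M A I X \<and> norm E = 1 \<and>
     (\<forall>p\<in>topspace M. \<forall>t\<in>I.
        ((\<lambda>\<tau>. X (p, \<tau>)) has_vector_derivative E) (at t within I)) \<and>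
     (\<forall>p\<in>topspace M. \<forall>t\<in>I. X (p, t) = \<gamma> p + t *\<^sub>R E)"

definition properly_immersed ::
  "'m topology \<Rightarrow> 'm chart set \<Rightarrow> ('m \<Rightarrow> real^2) \<Rightarrow> bool" where
  "properly_immersed M A \<gamma> \<longleftrightarrow>
     immersion A \<gamma> \<and>
     (\<forall>K. compact K \<longrightarrow> compactin M {p \<in> topspace M. \<gamma> p \<in> K})"

end

theory Submission
  imports Defs
begin

text \<open>
  Parametrise a profile curve by arc length over the real line and let it move in direction
  \<open>E = (0, -1)\<close>. The translator equation says that the third derivative of the tangent angle \<open>u\<close> is
  \<open>cos u\<close>; with \<open>p = u'\<close> and \<open>y = p'\<close> the curve is \<open>(y, g)\<close> where \<open>g' = sin u\<close>. The function
  \<open>H = p y - sin u\<close> satisfies \<open>H' = y\<^sup>2\<close>. Consider the odd solutions \<open>u\<close> with \<open>p 0 = a\<close>, for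
  which \<open>g\<close> is even.

  If \<open>H \<le> 1\<close> on the positive half line, the curve is proper: up to a constant \<open>g\<close> is \<open>p\<^sup>2 / 2\<close> minus
  the integral of \<open>H\<close>, which grows linearly, while \<open>p\<^sup>2 = o(s)\<close> by Cauchy-Schwarz since \<open>y\<close> is
  square integrable. Such an \<open>a\<close> is found by shooting. Once \<open>H > 1\<close>, the derivative \<open>H + sin u\<close> of
  \<open>p\<^sup>2 / 2\<close> is bounded below by a positive constant, so \<open>p\<close> escapes with a definite sign. The sets
  of \<open>a\<close> escaping upwards and downwards are open and disjoint; \<open>0\<close> escapes upwards and \<open>-4\<close> does
  not. Either \<open>-4\<close> does not escape at all, or it escapes downwards and, by connectedness, some \<open>a\<close>
  does not escape.
\<close>

section \<open>Globally Lipschitz ordinary differential equations\<close>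

lemma antiderivative_real_line:
  fixes g :: "real \<Rightarrow> 'a::euclidean_space"
  assumes "continuous_on UNIV g"
  obtains G where "G 0 = z" "\<And>t. (G has_vector_derivative g t) (at t)"
proof -
  obtain F where F: "\<And>t. (F has_vector_derivative g t) (at t)"
    using einterval_antiderivative[of "-\<infinity>" "\<infinity>" g] assms
    by (auto simp: continuous_on_eq_continuous_at)
  have "((\<lambda>t. F t - F 0 + z) has_vector_derivative g t) (at t)" for t
    using F[of t] by (auto intro!: derivative_eq_intros)
  then show ?thesis
    by (intro that[of "\<lambda>t. F t - F 0 + z"]) auto
qed

text \<open>A power bound is integrated from 0, on the negative side by reflection. The same
  estimate serves the Picard iterates, the identification of their limit, and the Taylor bounds on
  \<open>u\<close>, \<open>p\<close> and \<open>y\<close>.\<close>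

lemma norm_bound_of_derivative_power:
  fixes G g :: "real \<Rightarrow> 'a::real_normed_vector"
  assumes G: "\<And>r. \<bar>r\<bar> \<le> \<bar>t\<bar> \<Longrightarrow> (G has_vector_derivative g r) (at r)"
    and G0: "G 0 = 0"
    and g: "\<And>r. \<bar>r\<bar> \<le> \<bar>t\<bar> \<Longrightarrow> norm (g r) \<le> C * \<bar>r\<bar> ^ n"
  shows "norm (G t) \<le> C * \<bar>t\<bar> ^ Suc n / Suc n"
proof -
  have *: "norm (F t) \<le> C * t ^ Suc n / Suc n"
    if "t > 0" and F: "\<And>r. 0 \<le> r \<Longrightarrow> r \<le> t \<Longrightarrow> (F has_vector_derivative f r) (at r)"
      and F0: "F 0 = 0" and f: "\<And>r. 0 \<le> r \<Longrightarrow> r \<le> t \<Longrightarrow> norm (f r) \<le> C * r ^ n"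
    for t and F f :: "real \<Rightarrow> 'a"
  proof -
    let ?p = "\<lambda>r. C * r ^ Suc n / Suc n"
    have p: "(?p has_vector_derivative C * r ^ n) (at r)" for r
      unfolding has_real_derivative_iff_has_vector_derivative[symmetric]
      by (rule derivative_eq_intros refl | simp)+
    have "continuous_on {0..t} F"
      using F by (meson atLeastAtMost_iff continuous_at_imp_continuous_on has_vector_derivative_continuous)
    moreover have "continuous_on {0..t} ?p"
      by (intro continuous_intros) auto
    ultimately have "norm (F t - F 0) \<le> ?p t - ?p 0"
      using F f p by (intro differentiable_bound_general[OF \<open>t > 0\<close>, of F ?p f]) auto
    then show ?thesis using F0 by simp
  qed
  consider "t = 0" | "t > 0" | "t < 0" by linarith
  then show ?thesis
  proof cases
    case 1 then show ?thesis using G0 by simp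
  next
    case 2
    have "norm (G t) \<le> C * t ^ Suc n / Suc n"
    proof (rule *[OF 2])
      show "norm (g r) \<le> C * r ^ n" if "0 \<le> r" "r \<le> t" for r
        using g[of r] that by simp
    qed (use G G0 in auto)
    then show ?thesis using 2 by simp
  next
    case 3
    have "((\<lambda>r. G (- r)) has_vector_derivative - g (- r)) (at r)" if "0 \<le> r" "r \<le> - t" for r
    proof -
      have "(G has_vector_derivative g (- r)) (at (- r))" using G that 3 by auto
      then have "((G \<circ> uminus) has_vector_derivative (- 1) *\<^sub>R g (- r)) (at r)"
        by (intro vector_diff_chain_at) (auto intro!: derivative_eq_intros)
      then show ?thesis by (simp add: o_def)
    qed
    moreover have "norm (- g (- r)) \<le> C * r ^ n" if "0 \<le> r" "r \<le> - t" for r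
      using g[of "- r"] that by simp
    ultimately have "norm (G (- (- t))) \<le> C * (- t) ^ Suc n / Suc n"
      using 3 G0 by (intro *[of "- t" "\<lambda>r. G (- r)"]) auto
    then show ?thesis using 3 by simp
  qed
qed

text \<open>Picard iteration. Because the Lipschitz bound is global, the iterates are defined on the
  whole line and converge uniformly on each bounded interval, so no continuation of local solutions
  is involved.\<close>

theorem lipschitz_ode_exists:
  fixes f :: "'a::euclidean_space \<Rightarrow> 'a"
  assumes L: "L-lipschitz_on UNIV f"
  obtains z where "z 0 = z0" "\<And>t. (z has_vector_derivative f (z t)) (at t)"
proof -
  define prim where
    "prim g = (SOME G. G 0 = z0 \<and> (\<forall>t. (G has_vector_derivative g t) (at t)))"
    for g :: "real \<Rightarrow> 'a"
  have prim: "prim g 0 = z0 \<and> (\<forall>t. (prim g has_vector_derivative g t) (at t))"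
    if "continuous_on UNIV g" for g
    unfolding prim_def using antiderivative_real_line[OF that, of z0]
    by (intro someI_ex[of "\<lambda>G. G 0 = z0 \<and> (\<forall>t. (G has_vector_derivative g t) (at t))"]) blast
  have contf: "continuous_on UNIV f"
    by (rule lipschitz_on_continuous_on[OF L])
  have Lf: "norm (f x - f y) \<le> L * norm (x - y)" for x y
    using lipschitz_on_normD[OF L] by simp
  have Lpos: "L \<ge> 0" using lipschitz_on_nonneg[OF L] .
  have contfz: "continuous_on UNIV (\<lambda>t. f (z t))" if "continuous_on UNIV z" for z :: "real \<Rightarrow> 'a"
    using continuous_on_compose2[OF contf that] by simp
  define w where "w = rec_nat (\<lambda>_. z0) (\<lambda>_ z. prim (\<lambda>t. f (z t)))"
  have w0: "w 0 = (\<lambda>_. z0)" and wS: "w (Suc n) = prim (\<lambda>t. f (w n t))" for n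
    by (simp_all add: w_def)
  have contw: "continuous_on UNIV (w n)" for n
  proof (induction n)
    case (Suc n)
    then show ?case
      using prim[OF contfz[OF Suc]] unfolding wS
      by (meson continuous_at_imp_continuous_on has_vector_derivative_continuous)
  qed (simp add: w0)
  have wd: "(w (Suc n) has_vector_derivative f (w n t)) (at t)" for n t
    using prim[OF contfz[OF contw[of n]]] by (simp add: wS)
  have w_at0: "w n 0 = z0" for n
    using prim[OF contfz[OF contw]] by (cases n) (simp_all add: w0 wS)
  \<comment> \<open>The bound is \<open>norm (f z0) * L^n * abs t^(n+1) / (n+1)!\<close>; the
    factorial is split as \<open>fact n\<close> times \<open>Suc n\<close> to match the shape
    produced by \<open>norm_bound_of_derivative_power\<close>.\<close>
  have diff: "norm (w (Suc n) t - w n t) \<le> norm (f z0) * L ^ n / fact n * \<bar>t\<bar> ^ Suc n / Suc n" for n t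
  proof (induction n arbitrary: t)
    case 0
    have "norm (w (Suc 0) t - w 0 t) \<le> norm (f z0) * \<bar>t\<bar> ^ Suc 0 / Suc 0"
    proof (rule norm_bound_of_derivative_power)
      show "((\<lambda>t. w (Suc 0) t - w 0 t) has_vector_derivative f z0) (at r)" for r
        using wd[of 0 r] by (auto intro!: derivative_eq_intros simp: w0)
    qed (auto simp: w_at0)
    then show ?case by simp
  next
    case (Suc n)
    show ?case
    proof (rule norm_bound_of_derivative_power)
      show "((\<lambda>t. w (Suc (Suc n)) t - w (Suc n) t) has_vector_derivative
          f (w (Suc n) r) - f (w n r)) (at r)" for r
        by (intro derivative_intros wd)
      fix r
      have "norm (f (w (Suc n) r) - f (w n r)) \<le> L * norm (w (Suc n) r - w n r)"
        by (rule Lf)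
      also have "\<dots> \<le> L * (norm (f z0) * L ^ n / fact n * \<bar>r\<bar> ^ Suc n / Suc n)"
        by (intro mult_left_mono Suc Lpos)
      finally show "norm (f (w (Suc n) r) - f (w n r))
          \<le> norm (f z0) * L ^ Suc n / fact (Suc n) * \<bar>r\<bar> ^ Suc n"
        by (simp add: field_simps)
    qed (simp add: w_at0)
  qed
  define z where "z t = z0 + (\<Sum>i. w (Suc i) t - w i t)" for t
  have unif: "uniform_limit {-R..R} w z sequentially" for R
  proof -
    define R' where "R' = \<bar>R\<bar>"
    have "uniform_limit {-R..R} (\<lambda>n t. \<Sum>i<n. w (Suc i) t - w i t)
        (\<lambda>t. \<Sum>i. w (Suc i) t - w i t) sequentially"
    proof (rule Weierstrass_m_test)
      show "norm (w (Suc n) t - w n t) \<le> norm (f z0) * R' * ((L * R') ^ n /\<^sub>R fact n)"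
        if t: "t \<in> {-R..R}" for n t
      proof -
        have tR: "\<bar>t\<bar> \<le> R'" using t by (auto simp: R'_def)
        have "norm (w (Suc n) t - w n t) \<le> norm (f z0) * L ^ n / fact n * \<bar>t\<bar> ^ Suc n / Suc n"
          by (rule diff)
        also have "\<dots> \<le> norm (f z0) * L ^ n / fact n * \<bar>t\<bar> ^ Suc n"
          using Lpos by (intro divide_le_eq[THEN iffD2]) (auto intro!: mult_left_mono simp: field_simps)
        also have "\<dots> \<le> norm (f z0) * L ^ n / fact n * R' ^ Suc n"
          using Lpos tR by (intro mult_left_mono power_mono) auto
        finally show ?thesis by (simp add: field_simps power_mult_distrib)
      qed
      show "summable (\<lambda>n. norm (f z0) * R' * ((L * R') ^ n /\<^sub>R fact n))"
        by (intro summable_mult summable_exp_generic)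
    qed
    then have "uniform_limit {-R..R} (\<lambda>n t. z0 + (\<Sum>i<n. w (Suc i) t - w i t)) z sequentially"
      unfolding z_def by (intro uniform_limit_intros)
    moreover have "z0 + (\<Sum>i<n. w (Suc i) t - w i t) = w n t" for n t
      using sum_lessThan_telescope[of "\<lambda>i. w i t" n] by (simp add: w0)
    ultimately show ?thesis by simp
  qed
  have contz: "continuous_on UNIV z"
  proof -
    have "isCont z t" for t
    proof -
      have "continuous_on {-(\<bar>t\<bar> + 1)..\<bar>t\<bar> + 1} z"
        by (rule uniform_limit_theorem[OF _ unif])
          (auto intro: always_eventually continuous_on_subset[OF contw])
      then show ?thesis
        by (rule continuous_on_interior) auto
    qed
    then show ?thesis by (simp add: continuous_at_imp_continuous_on)
  qed
  obtain G where G0: "G 0 = z0" and G: "\<And>t. (G has_vector_derivative f (z t)) (at t)"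
    using antiderivative_real_line[OF contfz[OF contz], of z0] by blast
  \<comment> \<open>Both sides are limits of \<open>w (Suc n) t\<close>: its derivative
    \<open>f (w n)\<close> tends uniformly to \<open>f z\<close> between 0 and \<open>t\<close>, so
    its values tend to those of the antiderivative \<open>G\<close>. The \<open>+ 1\<close> in
    \<open>d\<close> below keeps the denominator positive when \<open>L * abs t = 0\<close>.\<close>
  have "z t = G t" for t
  proof (rule LIMSEQ_unique)
    have "t \<in> {-\<bar>t\<bar>..\<bar>t\<bar>}" by (auto simp: abs_if)
    then show "(\<lambda>n. w (Suc n) t) \<longlonglongrightarrow> z t"
      by (intro LIMSEQ_Suc tendsto_uniform_limitI[OF unif])
    show "(\<lambda>n. w (Suc n) t) \<longlonglongrightarrow> G t"
    proof (rule LIMSEQ_I)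
      fix e :: real assume "e > 0"
      define d where "d = e / (L * \<bar>t\<bar> + 1)"
      have den: "L * \<bar>t\<bar> + 1 > 0" using Lpos by (simp add: add_nonneg_pos)
      have "d > 0" using \<open>e > 0\<close> den by (simp add: d_def)
      from uniform_limitD[OF unif[of "\<bar>t\<bar>"] this] obtain N
        where N: "\<And>n r. n \<ge> N \<Longrightarrow> r \<in> {-\<bar>t\<bar>..\<bar>t\<bar>} \<Longrightarrow> dist (w n r) (z r) < d"
        unfolding eventually_sequentially by blast
      have "norm (w (Suc n) t - G t) < e" if "n \<ge> N" for n
      proof -
        have "norm (w (Suc n) t - G t) \<le> (L * d) * \<bar>t\<bar> ^ Suc 0 / Suc 0"
        proof (rule norm_bound_of_derivative_power)
          show "((\<lambda>t. w (Suc n) t - G t) has_vector_derivative f (w n r) - f (z r)) (at r)" for r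
            by (intro derivative_intros wd G)
          show "norm (f (w n r) - f (z r)) \<le> L * d * \<bar>r\<bar> ^ 0" if "\<bar>r\<bar> \<le> \<bar>t\<bar>" for r
          proof -
            have "norm (w n r - z r) \<le> d"
              using N[OF \<open>n \<ge> N\<close>, of r] that by (auto simp: dist_norm abs_le_iff)
            then show ?thesis
              using order_trans[OF Lf mult_left_mono[OF _ Lpos]] by simp
          qed
        qed (simp add: w_at0 G0)
        also have "\<dots> = e * (L * \<bar>t\<bar> / (L * \<bar>t\<bar> + 1))"
          by (simp add: d_def)
        also have "\<dots> < e * 1"
          using den \<open>e > 0\<close> by (intro mult_strict_left_mono) (auto simp: divide_less_eq)
        finally show ?thesis by simp
      qed
      then show "\<exists>N. \<forall>n\<ge>N. norm (w (Suc n) t - G t) < e" by blast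
    qed
  qed
  then have "z = G" by auto
  then show ?thesis using G0 G that by blast
qed

text \<open>Gronwall's argument for the squared distance, which unlike the norm is differentiable
  where the solutions meet: \<open>exp (- 2 * L * t) * q t\<close> is nonincreasing.\<close>

lemma lipschitz_ode_dependence:
  fixes f :: "'a::real_inner \<Rightarrow> 'a"
  assumes L: "L-lipschitz_on UNIV f"
    and v: "\<And>t. (v has_vector_derivative f (v t)) (at t)"
    and w: "\<And>t. (w has_vector_derivative f (w t)) (at t)"
    and "t \<ge> 0"
  shows "norm (v t - w t) \<le> exp (L * t) * norm (v 0 - w 0)"
proof -
  define q where "q t = (v t - w t) \<bullet> (v t - w t)" for t
  have q: "(q has_real_derivative 2 * ((v t - w t) \<bullet> (f (v t) - f (w t)))) (at t)" for t
    unfolding q_def has_field_derivative_def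
    using v[of t] w[of t] unfolding has_vector_derivative_def
    by (auto intro!: derivative_eq_intros simp: inner_commute inner_diff_left inner_diff_right algebra_simps)
  have "exp (- 2 * L * t) * q t \<le> exp (- 2 * L * 0) * q 0"
  proof (rule DERIV_nonpos_imp_nonincreasing[OF \<open>t \<ge> 0\<close>])
    fix r
    have "(v r - w r) \<bullet> (f (v r) - f (w r)) \<le> norm (v r - w r) * (L * norm (v r - w r))"
      using order_trans[OF norm_cauchy_schwarz mult_left_mono[OF lipschitz_on_normD[OF L]]] by simp
    also have "\<dots> = L * q r" by (simp add: q_def dot_square_norm power2_eq_square)
    finally have "exp (- 2 * L * r) * (2 * ((v r - w r) \<bullet> (f (v r) - f (w r))) - 2 * L * q r) \<le> 0"
      by (simp add: mult_le_0_iff)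
    moreover have "((\<lambda>t. exp (- 2 * L * t) * q t) has_real_derivative
      exp (- 2 * L * r) * (2 * ((v r - w r) \<bullet> (f (v r) - f (w r))) - 2 * L * q r)) (at r)"
      by (rule derivative_eq_intros q refl | simp add: algebra_simps)+
    ultimately show "\<exists>y. ((\<lambda>t. exp (- 2 * L * t) * q t) has_real_derivative y) (at r) \<and> y \<le> 0"
      by blast
  qed
  then have "q t \<le> exp (2 * L * t) * q 0"
    by (simp add: exp_minus field_simps)
  then have "(norm (v t - w t))\<^sup>2 \<le> (exp (L * t) * norm (v 0 - w 0))\<^sup>2"
    by (simp add: q_def dot_square_norm power_mult_distrib mult.assoc flip: exp_double)
  then show ?thesis by (rule power2_le_imp_le) simp
qed

section \<open>The equation for the tangent angle\<close>

definition angle_ode :: "real \<times> real \<times> real \<Rightarrow> real \<times> real \<times> real" where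
  "angle_ode = (\<lambda>(u, p, y). (p, y, cos u))"

lemma abs_cos_diff_le: "\<bar>cos x - cos y\<bar> \<le> \<bar>x - y\<bar>" for x y :: real
  using field_differentiable_bound[of UNIV cos "\<lambda>x. - sin x" 1 x y]
  by (auto intro!: derivative_eq_intros)

lemma angle_ode_lipschitz: "1-lipschitz_on UNIV angle_ode"
proof (rule lipschitz_onI)
  fix v w :: "real \<times> real \<times> real"
  obtain u p y u' p' y' where vw: "v = (u, p, y)" "w = (u', p', y')"
    by (cases v, cases w) auto
  have "(cos u - cos u')\<^sup>2 \<le> (u - u')\<^sup>2"
    using power_mono[OF abs_cos_diff_le, of u u' 2] by simp
  then show "dist (angle_ode v) (angle_ode w) \<le> 1 * dist v w"
    by (simp add: vw angle_ode_def dist_Pair_Pair dist_real_def)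
qed simp

lemma le_of_deriv_le:
  fixes f g :: "real \<Rightarrow> real"
  assumes "0 \<le> s" "f 0 \<le> g 0"
    and "\<And>r. (f has_real_derivative f' r) (at r)" "\<And>r. (g has_real_derivative g' r) (at r)"
    and "\<And>r. 0 \<le> r \<Longrightarrow> f' r \<le> g' r"
  shows "f s \<le> g s"
proof -
  have "g 0 - f 0 \<le> g s - f s"
  proof (rule DERIV_nonneg_imp_nondecreasing[OF assms(1)])
    fix r :: real assume "0 \<le> r"
    then show "\<exists>d. ((\<lambda>r. g r - f r) has_real_derivative d) (at r) \<and> d \<ge> 0"
      using assms(5) by (intro exI[of _ "g' r - f' r"] conjI DERIV_diff assms(3,4)) simp
  qed
  then show ?thesis using assms(2) by linarith
qed

text \<open>The conditions at 0 select the odd solutions; \<open>p 0\<close> stays free and becomes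
  the shooting parameter.\<close>

locale angle_profile =
  fixes u p y :: "real \<Rightarrow> real"
  assumes u': "(u has_real_derivative p s) (at s)"
    and p': "(p has_real_derivative y s) (at s)"
    and y': "(y has_real_derivative cos (u s)) (at s)"
    and u_0: "u 0 = 0" and y_0: "y 0 = 0"
begin

lemma as_ode_solution: "((\<lambda>s. (u s, p s, y s)) has_vector_derivative angle_ode (u s, p s, y s)) (at s)"
  unfolding angle_ode_def
  using u'[of s] p'[of s] y'[of s]
  by (auto simp: has_real_derivative_iff_has_vector_derivative intro!: has_vector_derivative_Pair)

definition H :: "real \<Rightarrow> real" where
  "H s = p s * y s - sin (u s)"

lemma H': "(H has_real_derivative (y s)\<^sup>2) (at s)"
  unfolding H_def
  by (rule derivative_eq_intros u' p' y' refl | simp add: power2_eq_square)+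

lemma H_0: "H 0 = 0"
  by (simp add: H_def u_0 y_0)

lemma H_mono: "s \<le> t \<Longrightarrow> H s \<le> H t"
  by (rule DERIV_nonneg_imp_nondecreasing) (auto intro: H')

lemma H_nonneg: "s \<ge> 0 \<Longrightarrow> H s \<ge> 0"
  using H_mono[of 0 s] H_0 by simp

text \<open>Otherwise the monotone \<open>H\<close> vanishes on [0, 1], hence so does
  \<open>y\<close> on [0, 1), and then \<open>cos (u s) = 0\<close> for 0 < s < 1. Letting s
  decrease to 0 contradicts \<open>u 0 = 0\<close>. The value \<open>H 1\<close> later supplies the
  rate at which the curve descends.\<close>

lemma H_nontrivial: "H 1 > 0"
proof (rule ccontr)
  assume "\<not> H 1 > 0"
  then have H0: "H s = 0" if "0 \<le> s" "s \<le> 1" for s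
    using H_mono[of s 1] H_nonneg[of s] that by force
  have "(y s)\<^sup>2 = 0" if "0 < s" "s < 1" for s
  proof (rule DERIV_unique[OF H'])
    have "eventually (\<lambda>r. r \<in> {0<..<1}) (nhds s)"
      using that by (intro eventually_nhds_in_open) auto
    then have "eventually (\<lambda>r. H r = 0) (nhds s)"
      by eventually_elim (auto simp: H0)
    then show "(H has_real_derivative 0) (at s)"
      by (subst DERIV_cong_ev[OF refl _ refl]) auto
  qed
  then have y0: "y s = 0" if "0 \<le> s" "s < 1" for s
    using that y_0 by (cases "s = 0") auto
  have "cos (u s) = 0" if "0 < s" "s < 1" for s
  proof (rule DERIV_unique[OF y'])
    have "eventually (\<lambda>r. r \<in> {0<..<1}) (nhds s)"
      using that by (intro eventually_nhds_in_open) auto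
    then have "eventually (\<lambda>r. y r = 0) (nhds s)"
      by eventually_elim (auto simp: y0)
    then show "(y has_real_derivative 0) (at s)"
      by (subst DERIV_cong_ev[OF refl _ refl]) auto
  qed
  then have "eventually (\<lambda>s. cos (u s) = 0) (at_right 0)"
    by (auto simp: eventually_at_right_field intro!: exI[of _ 1])
  then have "((\<lambda>s. cos (u s)) \<longlongrightarrow> 0) (at_right 0)"
    by (rule tendsto_eventually)
  moreover have "isCont (\<lambda>s. cos (u s)) 0"
    using DERIV_isCont[OF u'] by (intro continuous_intros)
  then have "((\<lambda>s. cos (u s)) \<longlongrightarrow> cos (u 0)) (at_right 0)"
    by (auto simp: isCont_def intro: filterlim_mono[OF _ order_refl at_le])
  ultimately show False
    using tendsto_unique[of "at_right (0::real)"] u_0 by fastforce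
qed

text \<open>Once \<open>H\<close> exceeds \<open>1\<close>, the derivative \<open>p * y = H + sin u\<close> of \<open>p\<^sup>2 / 2\<close> stays positive.\<close>

lemma escape:
  assumes "H s > 1" "s < t"
  shows "(p s)\<^sup>2 < (p t)\<^sup>2"
proof (rule DERIV_pos_imp_increasing[OF \<open>s < t\<close>])
  fix r assume "s \<le> r"
  have "sin (u r) \<ge> - 1" by simp
  then have "2 * (p r * y r) > 0"
    using H_mono[OF \<open>s \<le> r\<close>] assms(1) unfolding H_def by linarith
  moreover have "((\<lambda>r. (p r)\<^sup>2) has_real_derivative 2 * (p r * y r)) (at r)"
    by (rule derivative_eq_intros p' refl | simp)+
  ultimately show "\<exists>d. ((\<lambda>r. (p r)\<^sup>2) has_real_derivative d) (at r) \<and> d > 0"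
    by blast
qed

lemma isCont_p: "isCont p s"
  by (rule DERIV_isCont[OF p'])

text \<open>A change of sign would force a zero of \<open>p\<close> after time \<open>s\<close>,
  where \<open>p\<close> squared would be below its earlier value.\<close>

lemma escape_sign:
  assumes "H s > 1" "s \<le> t" "p s * p t < 0"
  shows False
proof -
  have "\<exists>r. s \<le> r \<and> r \<le> t \<and> p r = 0"
  proof (cases "p s < 0")
    case True
    then show ?thesis
      using assms(2,3) by (intro IVT) (auto simp: isCont_p mult_less_0_iff)
  next
    case False
    then show ?thesis
      using assms(2,3) by (intro IVT2) (auto simp: isCont_p mult_less_0_iff)
  qed
  then obtain r where r: "s \<le> r" "p r = 0" by blast
  then have "s < r" using assms(3) by (cases "s = r") auto
  then show False using escape[OF assms(1)] r by fastforce
qed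

lemma escape_exclusive:
  assumes "H s > 1" "p s > 0" "H t > 1" "p t < 0"
  shows False
  using escape_sign[of s t] escape_sign[of t s] assms
  by (cases "s \<le> t") (auto simp: mult_less_0_iff)

lemma no_escape:
  assumes "\<not> (\<exists>s\<ge>0. H s > 1 \<and> p s > 0)" "\<not> (\<exists>s\<ge>0. H s > 1 \<and> p s < 0)" "s \<ge> 0"
  shows "H s \<le> 1"
proof (rule ccontr)
  assume "\<not> H s \<le> 1"
  \<comment> \<open>\<open>p s\<close> itself may vanish; by strict growth of its square,
    \<open>p\<close> is nonzero one unit later.\<close>
  then have "H (s + 1) > 1" "p (s + 1) \<noteq> 0"
    using H_mono[of s "s + 1"] escape[of s "s + 1"] by auto
  then have "s + 1 \<ge> 0" "H (s + 1) > 1" "p (s + 1) < 0 \<or> p (s + 1) > 0"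
    using \<open>s \<ge> 0\<close> by auto
  then show False using assms(1,2) by blast
qed

lemma abs_u_le:
  assumes p0: "p 0 = 0"
  shows "\<bar>u s\<bar> \<le> \<bar>s\<bar> ^ 3 / 6"
proof -
  have y: "\<bar>y s\<bar> \<le> 1 * \<bar>s\<bar> ^ Suc 0 / Suc 0" for s
    using norm_bound_of_derivative_power[of s y "\<lambda>s. cos (u s)" 1 0] y' y_0
    by (simp add: has_real_derivative_iff_has_vector_derivative)
  have p: "\<bar>p s\<bar> \<le> 1 * \<bar>s\<bar> ^ Suc 1 / Suc 1" for s
    using norm_bound_of_derivative_power[of s p y 1 1] p' p0 y
    by (simp add: has_real_derivative_iff_has_vector_derivative)
  have "\<bar>u s\<bar> \<le> (1/2) * \<bar>s\<bar> ^ Suc 2 / Suc 2"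
    using norm_bound_of_derivative_power[of s u p "1/2" 2] u' u_0 p
    by (simp add: has_real_derivative_iff_has_vector_derivative power2_eq_square)
  then show ?thesis by (simp add: numeral_3_eq_3)
qed

text \<open>Explicit Taylor estimates: \<open>abs_u_le\<close> and
  \<open>cos x >= 1 - x^2 / 2\<close> give a lower bound for \<open>cos (u s)\<close>, which is
  integrated twice to bound \<open>y\<close> and \<open>p\<close>. At 3/2 the product
  \<open>p * y\<close> is at least 1.62, while \<open>sin u\<close> is at most
  \<open>(3/2)^3 / 6 = 0.5625\<close>.\<close>

lemma escape_upwards:
  assumes p0: "p 0 = 0"
  shows "H (3/2) > 1" "p (3/2) > 0"
proof -
  have y: "s - s ^ 7 / 504 \<le> y s" if "s \<ge> 0" for s
  proof (rule le_of_deriv_le[OF that])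
    fix r :: real assume "r \<ge> 0"
    have "(u r)\<^sup>2 \<le> (r ^ 3 / 6)\<^sup>2"
      using abs_u_le[OF p0, of r] \<open>r \<ge> 0\<close> by (intro power2_le_iff_abs_le[THEN iffD2]) auto
    moreover have "1 - (u r)\<^sup>2 / 2 \<le> cos (u r)"
    proof -
      have "(sin (u r / 2))\<^sup>2 \<le> (u r / 2)\<^sup>2"
        by (rule abs_le_square_iff[THEN iffD1, OF abs_sin_x_le_abs_x])
      then show ?thesis
        using cos_double_sin[of "u r / 2"] by (simp add: power_divide)
    qed
    ultimately show "1 - r ^ 6 / 72 \<le> cos (u r)"
      by (simp add: power_divide flip: power_mult)
  qed (auto intro!: derivative_eq_intros y' simp: y_0)
  have p: "s\<^sup>2 / 2 - s ^ 8 / 4032 \<le> p s" if "s \<ge> 0" for s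
    by (rule le_of_deriv_le[OF that, of _ _ "\<lambda>s. s - s ^ 7 / 504" y])
      (use y in \<open>auto intro!: derivative_eq_intros p' simp: p0\<close>)
  have y32: "y (3/2) \<ge> 1.46" and p32: "p (3/2) \<ge> 1.11"
    using y[of "3/2"] p[of "3/2"] by (simp_all add: power_divide)
  have "p (3/2) * y (3/2) \<ge> 1.11 * 1.46"
    using y32 p32 by (intro mult_mono) auto
  moreover have "sin (u (3/2)) \<le> 0.5625"
    using abs_u_le[OF p0, of "3/2"] abs_sin_x_le_abs_x[of "u (3/2)"] by (simp add: power_divide)
  ultimately show "H (3/2) > 1" by (simp add: H_def)
  show "p (3/2) > 0" using p32 by simp
qed

text \<open>To become positive, \<open>p\<close> must first climb from -4 to -2. Up to that time
  \<open>H\<close> is at most 1, since an escape with negative \<open>p\<close> excludes one with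
  positive \<open>p\<close>. The corrected energy \<open>L\<close> below is nondecreasing on this
  interval, although the climb would have to lower it.\<close>

lemma no_escape_upwards:
  assumes p0: "p 0 = - 4" and s: "s \<ge> 0" "H s > 1" "p s > 0"
  shows False
proof -
  define S where "S = Inf {t. 0 \<le> t \<and> - 2 \<le> p t}"
  have closed: "closed {t. 0 \<le> t \<and> - 2 \<le> p t}"
    by (intro closed_Collect_conj closed_Collect_le continuous_intros)
      (simp_all add: continuous_at_imp_continuous_on isCont_p)
  have S: "S \<in> {t. 0 \<le> t \<and> - 2 \<le> p t}"
    unfolding S_def using s by (intro closed_contains_Inf closed) (auto intro: bdd_belowI[of _ 0])
  have below: "p t < - 2" if "0 \<le> t" "t < S" for t
    using cInf_lower[of t "{t. 0 \<le> t \<and> - 2 \<le> p t}"] that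
    by (force simp: S_def intro: bdd_belowI[of _ 0])
  have le: "p t \<le> - 2" if "0 \<le> t" "t \<le> S" for t
  proof (rule ccontr)
    assume "\<not> p t \<le> - 2"
    then have "- 2 < p t" by simp
    then obtain r where r: "0 \<le> r" "r \<le> t" "p r = - 2"
      using IVT[of p 0 "-2" t] \<open>0 \<le> t\<close> p0 isCont_p by force
    then have "r \<noteq> t" using \<open>- 2 < p t\<close> by auto
    then show False using below[of r] r that by simp
  qed
  have pS: "p S = - 2" using le[of S] S by auto
  have H1: "H t \<le> 1" if "0 \<le> t" "t \<le> S" for t
    using escape_exclusive[of s t] s le[OF that] by force
  txt \<open>\<open>L\<close> is \<open>p\<^sup>2 / 2\<close> plus the boundary terms left by integrating the oscillating part \<open>sin u\<close> of
    its derivative \<open>H + sin u\<close> by parts (twice, using \<open>cos u = y'\<close>); the remaining error \<open>(y / p) ^ 3\<close>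
    is dominated by \<open>H' = y\<^sup>2\<close>, which is integrable.\<close>
  define q where "q t = inverse (p t)" for t
  have q': "(q has_real_derivative - (y t * (q t)\<^sup>2)) (at t)" if "p t \<noteq> 0" for t
    using DERIV_inverse'[OF p' that] by (simp add: q_def[abs_def] power2_eq_square mult_ac)
  define L where "L t = (p t)\<^sup>2 / 2 + cos (u t) * q t + (y t)\<^sup>2 * (q t)\<^sup>2 / 2 + H t / 8" for t
  have y_cube: "(y t / p t) ^ 3 \<le> (y t)\<^sup>2 / 8" if t: "0 \<le> t" "t \<le> S" for t
  proof -
    have "p t * y t \<le> 2"
      using H1[OF t] sin_le_one[of "u t"] unfolding H_def by linarith
    have "(y t / p t) ^ 3 = (y t)\<^sup>2 * ((p t * y t) / (p t) ^ 4)"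
      using le[OF t] by (simp add: field_simps eval_nat_numeral)
    also have "\<dots> \<le> (y t)\<^sup>2 * (1 / 8)"
    proof (intro mult_left_mono)
      \<comment> \<open>The factor 1/8 is 2/16: \<open>p * y = H + sin u\<close> is at most 2 and
        \<open>p\<close> is at most -2.\<close>
      have "(p t) ^ 4 \<ge> 2 ^ 4"
        using power_mono[of 2 "- p t" 4] le[OF t] by simp
      then show "(p t * y t) / (p t) ^ 4 \<le> 1 / 8"
        using \<open>p t * y t \<le> 2\<close> by (subst pos_divide_le_eq) auto
    qed simp
    finally show ?thesis by simp
  qed
  have "L 0 \<le> L S"
  proof (rule DERIV_nonneg_imp_nondecreasing[of 0 S L])
    fix t assume t: "0 \<le> t" "t \<le> S"
    have "p t \<noteq> 0" using le[OF t] by simp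
    have "(L has_real_derivative (2 * p t * y t) / 2
        + (- sin (u t) * p t * q t + cos (u t) * - (y t * (q t)\<^sup>2))
        + ((2 * y t * cos (u t)) * (q t)\<^sup>2 + (y t)\<^sup>2 * (2 * q t * - (y t * (q t)\<^sup>2))) / 2 + (y t)\<^sup>2 / 8) (at t)"
    proof -
      have sq: "((\<lambda>x. (f x)\<^sup>2) has_real_derivative 2 * f t * d) (at t)"
        if "(f has_real_derivative d) (at t)" for f d
        using DERIV_power[OF that, of 2] by (simp add: mult_ac)
      have prod: "((\<lambda>x. f x * g x) has_real_derivative d * g t + f t * e) (at t)"
        if "(f has_real_derivative d) (at t)" "(g has_real_derivative e) (at t)" for f g d e
        using DERIV_mult[OF that] by (simp add: mult_ac)
      have "((\<lambda>t. cos (u t)) has_real_derivative - sin (u t) * p t) (at t)"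
        by (auto intro!: derivative_eq_intros u')
      then show ?thesis
        unfolding L_def
        by (intro DERIV_add DERIV_cdivide sq p' y' H' q' prod \<open>p t \<noteq> 0\<close>)
    qed
    moreover have "(2 * p t * y t) / 2
        + (- sin (u t) * p t * q t + cos (u t) * - (y t * (q t)\<^sup>2))
        + ((2 * y t * cos (u t)) * (q t)\<^sup>2 + (y t)\<^sup>2 * (2 * q t * - (y t * (q t)\<^sup>2))) / 2 + (y t)\<^sup>2 / 8
        = H t - (y t / p t) ^ 3 + (y t)\<^sup>2 / 8"
    proof -
      have pq: "- sin (u t) * p t * q t = - sin (u t)"
        using \<open>p t \<noteq> 0\<close> by (simp add: q_def)
      have "((2 * y t * cos (u t)) * (q t)\<^sup>2 + (y t)\<^sup>2 * (2 * q t * - (y t * (q t)\<^sup>2))) / 2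
          = cos (u t) * (y t * (q t)\<^sup>2) - (y t * q t) ^ 3"
        by (simp add: power2_eq_square power3_eq_cube algebra_simps diff_divide_distrib)
      moreover have yq: "(y t / p t) ^ 3 = (y t * q t) ^ 3"
        by (simp add: q_def divide_inverse)
      ultimately show ?thesis
        unfolding pq yq H_def by linarith
    qed
    ultimately have "(L has_real_derivative H t - (y t / p t) ^ 3 + (y t)\<^sup>2 / 8) (at t)"
      by (simp only:)
    moreover have "H t - (y t / p t) ^ 3 + (y t)\<^sup>2 / 8 \<ge> 0"
      using y_cube[OF t] H_nonneg[OF t(1)] by simp
    ultimately show "\<exists>d. (L has_real_derivative d) (at t) \<and> d \<ge> 0" by blast
  qed (use S in auto)
  \<comment> \<open>The contradiction is between 7.75 at the start and at most 3.125 at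
    \<open>S\<close>. The drop of \<open>p^2 / 2\<close> from 8 to 2 outweighs all correction
    terms.\<close>
  moreover have "L 0 = 8 - 1/4"
    by (simp add: L_def q_def p0 u_0 y_0 H_0)
  moreover have "L S \<le> 2 + 1/2 + 1/2 + 1/8"
  proof -
    \<comment> \<open>At \<open>S\<close> the bounds on \<open>H\<close> say that
      \<open>- 2 * y S - sin (u S)\<close> lies in [0, 1], so \<open>- 2 * y S\<close> lies in
      [-1, 2].\<close>
    have "\<bar>y S\<bar> \<le> 1"
    proof (rule abs_leI)
      have "- 2 * y S - sin (u S) \<le> 1" "- 2 * y S - sin (u S) \<ge> 0"
        using H1[of S] H_nonneg[of S] S by (simp_all add: H_def pS)
      then show "y S \<le> 1" "- y S \<le> 1"
        using sin_le_one[of "u S"] sin_ge_minus_one[of "u S"] by linarith+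
    qed
    then have "(y S)\<^sup>2 \<le> 1" by (simp add: abs_square_le_1)
    moreover have "L S = 2 - cos (u S) / 2 + (y S)\<^sup>2 / 8 + H S / 8"
      by (simp add: L_def q_def pS power2_eq_square)
    moreover have "H S \<le> 1" using H1[of S] S by simp
    ultimately show ?thesis
      using cos_ge_minus_one[of "u S"] by linarith
  qed
  ultimately show False by simp
qed

end

section \<open>Existence, symmetry and shooting in the initial curvature\<close>

lemma angle_profile_exists: "\<exists>u p y. angle_profile u p y \<and> p 0 = a"
proof -
  obtain z where z0: "z 0 = (0, a, 0)" and z: "\<And>t. (z has_vector_derivative angle_ode (z t)) (at t)"
    using lipschitz_ode_exists[OF angle_ode_lipschitz] by blast
  have fst: "((\<lambda>t. fst (z t)) has_vector_derivative fst (angle_ode (z t))) (at t)" for t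
    by (rule bounded_linear.has_vector_derivative[OF bounded_linear_fst z])
  have snd: "((\<lambda>t. snd (z t)) has_vector_derivative snd (angle_ode (z t))) (at t)" for t
    by (rule bounded_linear.has_vector_derivative[OF bounded_linear_snd z])
  have "angle_profile (\<lambda>t. fst (z t)) (\<lambda>t. fst (snd (z t))) (\<lambda>t. snd (snd (z t)))"
    using fst bounded_linear.has_vector_derivative[OF bounded_linear_fst snd]
      bounded_linear.has_vector_derivative[OF bounded_linear_snd snd]
    by (intro angle_profile.intro)
      (simp_all add: z0 has_real_derivative_iff_has_vector_derivative angle_ode_def case_prod_beta)
  moreover have "fst (snd (z 0)) = a" by (simp add: z0)
  ultimately show ?thesis by (intro exI[of _ "\<lambda>t. fst (z t)"] exI[of _ "\<lambda>t. fst (snd (z t))"]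
        exI[of _ "\<lambda>t. snd (snd (z t))"] conjI)
qed

lemma angle_profile_dependence:
  assumes "angle_profile u p y" "angle_profile u' p' y'" "s \<ge> 0"
  shows "norm ((u s, p s, y s) - (u' s, p' s, y' s)) \<le> exp s * \<bar>p 0 - p' 0\<bar>"
  using lipschitz_ode_dependence[OF angle_ode_lipschitz
      angle_profile.as_ode_solution[OF assms(1)] angle_profile.as_ode_solution[OF assms(2)] assms(3)]
    angle_profile.u_0[OF assms(1)] angle_profile.u_0[OF assms(2)]
    angle_profile.y_0[OF assms(1)] angle_profile.y_0[OF assms(2)]
  by (simp add: norm_Pair)

text \<open>The reflected triple is again a profile with the same value of \<open>p\<close> at 0, so
  continuous dependence with zero initial difference makes the two coincide.\<close>

lemma angle_profile_odd:
  assumes "angle_profile u p y"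
  shows "u (- s) = - u s"
proof -
  interpret angle_profile u p y by fact
  have refl: "angle_profile (\<lambda>s. - u (- s)) (\<lambda>s. p (- s)) (\<lambda>s. - y (- s))"
  proof
    fix s
    show "((\<lambda>s. - u (- s)) has_real_derivative p (- s)) (at s)"
      using DERIV_minus[OF DERIV_mirror[THEN iffD1, OF u'[of "- s"]]] by simp
    show "((\<lambda>s. p (- s)) has_real_derivative - y (- s)) (at s)"
      by (rule DERIV_mirror[THEN iffD1, OF p'[of "- s"]])
    show "((\<lambda>s. - y (- s)) has_real_derivative cos (- u (- s))) (at s)"
      using DERIV_minus[OF DERIV_mirror[THEN iffD1, OF y'[of "- s"]]] by simp
  qed (simp_all add: u_0 y_0)
  have "u (- s) = - u s" if "s \<ge> 0" for s
    using angle_profile_dependence[OF assms refl that] by (simp add: zero_prod_def)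
  from this[of s] this[of "- s"] show ?thesis by (cases "s \<ge> 0") auto
qed

theorem bounded_H_profile_exists:
  "\<exists>u p y. angle_profile u p y \<and> (\<forall>s\<ge>0. angle_profile.H u p y s \<le> 1)"
proof -
  obtain u p y where prof: "\<And>a. angle_profile (u a) (p a) (y a)" and p0: "\<And>a. p a 0 = a"
  proof -
    have "\<forall>a. \<exists>v. angle_profile (fst v) (fst (snd v)) (snd (snd v)) \<and> fst (snd v) 0 = a"
      using angle_profile_exists by simp
    from choice[OF this] obtain v where
      "\<And>a. angle_profile (fst (v a)) (fst (snd (v a))) (snd (snd (v a)))"
      "\<And>a. fst (snd (v a)) 0 = a" by blast
    then show ?thesis
      by (intro that[of "\<lambda>a. fst (v a)" "\<lambda>a. fst (snd (v a))" "\<lambda>a. snd (snd (v a))"]) auto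
  qed
  define H where "H a = angle_profile.H (u a) (p a) (y a)" for a
  have H_eq: "H a s = p a s * y a s - sin (u a s)" for a s
    using angle_profile.H_def[OF prof] by (simp add: H_def)
  \<comment> \<open>Continuity in \<open>a\<close> at each fixed time suffices, as \<open>U\<close>
    and \<open>V\<close> are unions over \<open>s\<close> of sets that are open in
    \<open>a\<close>.\<close>
  have cont: "isCont (\<lambda>a. (u a s, p a s, y a s)) a" if "s \<ge> 0" for a s
    unfolding continuous_at_eps_delta
  proof (intro allI impI)
    fix e :: real assume "e > 0"
    show "\<exists>d>0. \<forall>b. dist b a < d \<longrightarrow> dist (u b s, p b s, y b s) (u a s, p a s, y a s) < e"
    proof (intro exI[of _ "e / exp s"] conjI allI impI)
      fix b assume "dist b a < e / exp s"
      then have "exp s * \<bar>b - a\<bar> < e"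
        by (simp add: dist_real_def field_simps)
      then show "dist (u b s, p b s, y b s) (u a s, p a s, y a s) < e"
        using angle_profile_dependence[OF prof prof that, of b a] by (simp add: dist_norm p0)
    qed (use \<open>e > 0\<close> in simp)
  qed
  have cont_u: "continuous_on UNIV (\<lambda>a. u a s)" and cont_p: "continuous_on UNIV (\<lambda>a. p a s)"
    and cont_y: "continuous_on UNIV (\<lambda>a. y a s)" if "s \<ge> 0" for s
    using continuous_fst[OF cont[OF that]] continuous_fst[OF continuous_snd[OF cont[OF that]]]
      continuous_snd[OF continuous_snd[OF cont[OF that]]]
    by (simp_all add: continuous_on_eq_continuous_at)
  have cont_H: "continuous_on UNIV (\<lambda>a. H a s)" if "s \<ge> 0" for s
    unfolding H_eq by (intro continuous_intros cont_u cont_p cont_y that)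
  define U where "U = {a. \<exists>s\<ge>0. H a s > 1 \<and> p a s > 0}"
  define V where "V = {a. \<exists>s\<ge>0. H a s > 1 \<and> p a s < 0}"
  have "open U"
  proof -
    have "U = (\<Union>s\<in>{0..}. {a. H a s > 1} \<inter> {a. p a s > 0})" by (auto simp: U_def)
    moreover have "open \<dots>"
      by (intro open_UN ballI open_Int open_Collect_less continuous_on_const cont_H cont_p) auto
    ultimately show ?thesis by simp
  qed
  have "open V"
  proof -
    have "V = (\<Union>s\<in>{0..}. {a. H a s > 1} \<inter> {a. p a s < 0})" by (auto simp: V_def)
    moreover have "open \<dots>"
      by (intro open_UN ballI open_Int open_Collect_less continuous_on_const cont_H cont_p) auto
    ultimately show ?thesis by simp
  qed
  have "U \<inter> V = {}"
    using angle_profile.escape_exclusive[OF prof] unfolding U_def V_def H_def by blast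
  have "0 \<in> U"
    using angle_profile.escape_upwards[OF prof p0] by (auto simp: U_def H_def intro!: exI[of _ "3/2"])
  have "- 4 \<notin> U"
    using angle_profile.no_escape_upwards[OF prof p0] by (auto simp: U_def H_def)
  have "U \<union> V \<noteq> UNIV"
  proof
    assume "U \<union> V = UNIV"
    then have "- 4 \<in> V" using \<open>- 4 \<notin> U\<close> by auto
    then show False
      using connectedD[OF connected_UNIV \<open>open U\<close> \<open>open V\<close>] \<open>U \<inter> V = {}\<close> \<open>U \<union> V = UNIV\<close> \<open>0 \<in> U\<close>
      by auto
  qed
  then obtain a where "a \<notin> U" "a \<notin> V" by auto
  then have "\<forall>s\<ge>0. H a s \<le> 1"
    using angle_profile.no_escape[OF prof] unfolding U_def V_def H_def by blast
  then show ?thesis using prof unfolding H_def by blast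
qed

section \<open>Linear descent of the height when \<open>H\<close> is bounded\<close>

context angle_profile
begin

lemma p_increment:
  assumes "s < t"
  shows "(p t - p s)\<^sup>2 \<le> (t - s) * (H t - H s)"
proof -
  txt \<open>Cauchy-Schwarz for \<open>p' = y\<close> and \<open>H' = y\<^sup>2\<close>, from the nonnegativity of \<open>(y - c)\<^sup>2\<close>\<close>
  define c where "c = (p t - p s) / (t - s)"
  have "H s - 2 * c * p s + c\<^sup>2 * s \<le> H t - 2 * c * p t + c\<^sup>2 * t"
  proof (rule DERIV_nonneg_imp_nondecreasing[of s t "\<lambda>r. H r - 2 * c * p r + c\<^sup>2 * r"])
    fix r
    have "((\<lambda>r. H r - 2 * c * p r + c\<^sup>2 * r) has_real_derivative (y r - c)\<^sup>2) (at r)"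
      by (rule derivative_eq_intros H' p' refl | simp add: power2_eq_square algebra_simps)+
    then show "\<exists>d. ((\<lambda>r. H r - 2 * c * p r + c\<^sup>2 * r) has_real_derivative d) (at r) \<and> d \<ge> 0"
      by (intro exI[of _ "(y r - c)\<^sup>2"]) simp
  qed (use assms in simp)
  then have "2 * c * (p t - p s) - c\<^sup>2 * (t - s) \<le> H t - H s"
    by (simp add: algebra_simps)
  then have "(t - s) * (2 * c * (p t - p s) - c\<^sup>2 * (t - s)) \<le> (t - s) * (H t - H s)"
    using assms by (intro mult_left_mono) auto
  moreover have D: "p t - p s = c * (t - s)"
    using assms by (simp add: c_def)
  have "(t - s) * (2 * c * (p t - p s) - c\<^sup>2 * (t - s)) = (p t - p s)\<^sup>2"
    unfolding D by (simp add: power2_eq_square algebra_simps)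
  ultimately show ?thesis by simp
qed

text \<open>The derivative of \<open>g - p^2 / 2\<close> is \<open>- H\<close>, at most
  \<open>- h\<close> after time 1. Beyond a late time \<open>a\<close>, Cauchy-Schwarz lets
  \<open>p^2 / 2\<close> grow only at rate \<open>h / 2\<close>, so a net descent at rate
  \<open>h / 2\<close> remains.\<close>

lemma height_decreases_linearly:
  assumes H_le: "\<And>s. s \<ge> 0 \<Longrightarrow> H s \<le> 1"
    and g': "\<And>s. (g has_real_derivative sin (u s)) (at s)"
  obtains c C where "c > 0" "\<And>s. s \<ge> 0 \<Longrightarrow> g s \<le> C - c * s"
proof -
  define h where "h = H 1"
  have "h > 0" using H_nontrivial by (simp add: h_def)
  have bdd: "bdd_above (H ` {1..})"
    using H_le by (auto intro!: bdd_aboveI[of _ 1])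
  \<comment> \<open>The time \<open>a\<close> is chosen so late that the bounded monotone
    \<open>H\<close> has at most \<open>h / 2\<close> left to increase.\<close>
  have "Sup (H ` {1..}) - h / 2 < Sup (H ` {1..})" using \<open>h > 0\<close> by simp
  then obtain a where a: "a \<ge> 1" "Sup (H ` {1..}) - h / 2 < H a"
    by (subst (asm) less_cSup_iff[OF _ bdd]) auto
  have tail: "H s - H a \<le> h / 2" if "s \<ge> a" for s
    using cSup_upper[OF _ bdd, of "H s"] that a by auto
  define C where "C = \<bar>g a + (p a)\<^sup>2 / 2 + h / 2 * a\<bar>"
  have far: "g s \<le> C - h / 2 * s" if "s > a" for s
  proof -
    have "(p s - p a)\<^sup>2 \<le> (s - a) * (H s - H a)"
      by (rule p_increment[OF that])
    also have "\<dots> \<le> (s - a) * (h / 2)"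
      using tail[of s] that by (intro mult_left_mono) auto
    finally have inc: "(p s - p a)\<^sup>2 \<le> (s - a) * (h / 2)" .
    \<comment> \<open>Squaring a sum costs a factor 2; this cancels the 1/2 in
      \<open>p^2 / 2\<close> and is why the tail was taken below \<open>h / 2\<close>.\<close>
    have "(p s)\<^sup>2 \<le> 2 * (p s - p a)\<^sup>2 + 2 * (p a)\<^sup>2"
      using zero_le_power2[of "p s - 2 * p a"] by (simp add: power2_eq_square algebra_simps)
    then have "(p s)\<^sup>2 / 2 \<le> (s - a) * (h / 2) + (p a)\<^sup>2"
      using inc by linarith
    moreover have "g s - (p s)\<^sup>2 / 2 + h * s \<le> g a - (p a)\<^sup>2 / 2 + h * a"
    proof (rule DERIV_nonpos_imp_nonincreasing[of a s "\<lambda>s. g s - (p s)\<^sup>2 / 2 + h * s"])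
      fix r assume "a \<le> r"
      have "((\<lambda>s. g s - (p s)\<^sup>2 / 2 + h * s) has_real_derivative h - H r) (at r)"
        by (rule derivative_eq_intros g' p' refl | simp add: H_def)+
      moreover have "h - H r \<le> 0"
        using H_mono[of 1 r] a \<open>a \<le> r\<close> by (simp add: h_def)
      ultimately show "\<exists>d. ((\<lambda>s. g s - (p s)\<^sup>2 / 2 + h * s) has_real_derivative d) (at r) \<and> d \<le> 0"
        by blast
    qed (use that in simp)
    moreover have "(s - a) * (h / 2) = h * s / 2 - h * a / 2"
      by (simp add: field_simps)
    ultimately have "g s \<le> g a + (p a)\<^sup>2 / 2 + h / 2 * a - h / 2 * s"
      by simp
    then show ?thesis unfolding C_def by linarith
  qed
  have "continuous_on {0..a} g"
    using DERIV_isCont[OF g'] by (intro continuous_at_imp_continuous_on) auto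
  then have "bdd_above (g ` {0..a})"
    by (intro bounded_imp_bdd_above compact_imp_bounded compact_continuous_image) auto
  then obtain B where B: "\<And>s. s \<in> {0..a} \<Longrightarrow> g s \<le> B"
    unfolding bdd_above_def by blast
  show ?thesis
  \<comment> \<open>On [0, a] only the maximum of \<open>g\<close> is available; adding
    \<open>abs B\<close> and \<open>h / 2 * a\<close> to the constant absorbs this initial
    segment.\<close>
  proof (rule that[of "h / 2" "C + \<bar>B\<bar> + h / 2 * a"])
    fix s :: real assume "s \<ge> 0"
    show "g s \<le> C + \<bar>B\<bar> + h / 2 * a - h / 2 * s"
    proof (cases "s > a")
      case True
      then show ?thesis using far[OF True] \<open>h > 0\<close> a mult_nonneg_nonneg[of "h / 2" a] by linarith
    next
      case False
      then have "h / 2 * s \<le> h / 2 * a" using \<open>h > 0\<close> by (intro mult_left_mono) auto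
      moreover have "g s \<le> \<bar>B\<bar>" using B[of s] False \<open>s \<ge> 0\<close> by force
      ultimately show ?thesis by (simp add: C_def)
    qed
  qed (use \<open>h > 0\<close> in simp)
qed

end

section \<open>The translating curve\<close>

lemma even_antiderivative_of_odd:
  fixes f g :: "real \<Rightarrow> real"
  assumes g': "\<And>s. (g has_real_derivative f s) (at s)" and odd: "\<And>s. f (- s) = - f s"
  shows "g (- s) = g s"
proof -
  have "((\<lambda>s. g (- s) - g s) has_real_derivative 0) (at s)" for s
    using DERIV_diff[OF DERIV_mirror[THEN iffD1, OF g'[of "- s"]] g'[of s]] odd[of s] by simp
  then have "g (- s) - g s = g (- 0) - g 0"
    by (intro DERIV_isconst_all[of "\<lambda>s. g (- s) - g s"]) simp
  then show ?thesis by simp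
qed

section \<open>Smoothness from classes of functions closed under differentiation\<close>

lemma smooth_on_of_derivative_closed:
  assumes closed: "\<And>f. f \<in> \<C> \<Longrightarrow> \<exists>f'\<in>\<C>. \<forall>x. (f has_vector_derivative f' x) (at x)"
    and "f \<in> \<C>"
  shows "smooth_on S f"
proof -
  \<comment> \<open>\<open>D\<close> selects a derivative inside the class, so its iterates form the
    required sequence of derivatives.\<close>
  obtain D where D: "\<And>f. f \<in> \<C> \<Longrightarrow> D f \<in> \<C> \<and> (\<forall>x. (f has_vector_derivative D f x) (at x))"
    using bchoice[of \<C> "\<lambda>f f'. f' \<in> \<C> \<and> (\<forall>x. (f has_vector_derivative f' x) (at x))"] closed by blast
  have "(D ^^ k) f \<in> \<C>" for k
    using \<open>f \<in> \<C>\<close> D by (induction k) auto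
  then show ?thesis
    unfolding smooth_on_def using D by (intro exI[of _ "\<lambda>k. (D ^^ k) f"]) simp
qed

text \<open>The inductive form reduces closure under differentiation to the generators, by linearity
  and the Leibniz rule.\<close>

inductive_set generated_algebra :: "(real \<Rightarrow> real) set \<Rightarrow> (real \<Rightarrow> real) set" for B where
  const: "(\<lambda>_. c) \<in> generated_algebra B"
| gen: "f \<in> B \<Longrightarrow> f \<in> generated_algebra B"
| add: "f \<in> generated_algebra B \<Longrightarrow> g \<in> generated_algebra B \<Longrightarrow> (\<lambda>x. f x + g x) \<in> generated_algebra B"
| mult: "f \<in> generated_algebra B \<Longrightarrow> g \<in> generated_algebra B \<Longrightarrow> (\<lambda>x. f x * g x) \<in> generated_algebra B"

lemma generated_algebra_derivative:
  assumes "\<And>f. f \<in> B \<Longrightarrow> \<exists>f'\<in>generated_algebra B. \<forall>x. (f has_real_derivative f' x) (at x)"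
    and "f \<in> generated_algebra B"
  shows "\<exists>f'\<in>generated_algebra B. \<forall>x. (f has_real_derivative f' x) (at x)"
  using assms(2)
proof induction
  case (const c)
  show ?case by (rule bexI[OF _ generated_algebra.const[of 0]]) auto
next
  case (gen f)
  then show ?case by (rule assms(1))
next
  case (add f g)
  then obtain f' g' where "f' \<in> generated_algebra B" "g' \<in> generated_algebra B"
    "\<forall>x. (f has_real_derivative f' x) (at x)" "\<forall>x. (g has_real_derivative g' x) (at x)"
    by blast
  then show ?case
    by (intro bexI[of _ "\<lambda>x. f' x + g' x"] allI DERIV_add generated_algebra.add) auto
next
  case (mult f g)
  then obtain f' g' where "f' \<in> generated_algebra B" "g' \<in> generated_algebra B"
    "\<forall>x. (f has_real_derivative f' x) (at x)" "\<forall>x. (g has_real_derivative g' x) (at x)"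
    by blast
  with mult.hyps show ?case
    by (intro bexI[of _ "\<lambda>x. f' x * g x + g' x * f x"] allI DERIV_mult
        generated_algebra.add generated_algebra.mult) auto
qed

lemma vector_2_eq: "(vector [a, b] :: real^2) = a *\<^sub>R axis 1 1 + b *\<^sub>R axis 2 1"
  by (simp add: vec_eq_iff forall_2 axis_def)

lemma has_vector_derivative_vector_2:
  assumes "(f has_real_derivative a) (at s)" "(g has_real_derivative b) (at s)"
  shows "((\<lambda>s. vector [f s, g s] :: real^2) has_vector_derivative vector [a, b]) (at s)"
  unfolding vector_2_eq by (auto intro!: derivative_eq_intros assms)

lemma norm_cos_sin [simp]: "norm (vector [cos t, sin t] :: real^2) = 1"
  by (simp add: norm_eq_sqrt_inner inner_vec_def sum_2 flip: power2_eq_square)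

section \<open>The real line with one global chart, and curves of unit speed\<close>

abbreviation line_atlas :: "real chart set" where
  "line_atlas \<equiv> {(UNIV, id)}"

lemma local_rep_line [simp]: "local_rep (UNIV, id) f = f"
  by (simp add: local_rep_def inv_id)

lemma chart_deriv_line [simp]: "chart_deriv (UNIV, id) f s = vector_derivative f (at s)"
  by (simp add: chart_deriv_def)

lemma second_countable_euclidean: "second_countable (euclidean :: 'a::second_countable_topology topology)"
proof -
  obtain B :: "'a set set" where B: "countable B" "\<And>C. C \<in> B \<Longrightarrow> open C"
    "\<And>S. open S \<Longrightarrow> \<exists>U. U \<subseteq> B \<and> S = \<Union>U"
    using univ_second_countable by blast
  moreover have "\<exists>V\<in>B. x \<in> V \<and> V \<subseteq> U" if U: "open U" "x \<in> U" for U x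
  proof -
    obtain B' where "B' \<subseteq> B" "U = \<Union>B'" using B(3)[OF U(1)] by blast
    with U(2) show ?thesis by blast
  qed
  ultimately show ?thesis
    unfolding second_countable_def open_openin[symmetric] by (intro exI[of _ B]) blast
qed

lemma oriented_1_manifold_line: "oriented_1_manifold euclideanreal line_atlas"
proof -
  have "smooth_on UNIV (id :: real \<Rightarrow> real)"
    unfolding smooth_on_def
    by (intro exI[of _ "\<lambda>k. if k = 0 then (\<lambda>x. x) else if k = 1 then (\<lambda>_. 1) else (\<lambda>_. 0)"])
      (auto intro!: derivative_eq_intros)
  then show ?thesis
    by (simp add: oriented_1_manifold_def second_countable_euclidean)
qed

text \<open>With a single chart the choice of chart is forced, and unit speed makes the normalising
  factor 1.\<close>

lemma arc_deriv_unit_speed: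
  assumes "norm (vector_derivative \<gamma> (at s)) = 1" "(f has_vector_derivative v) (at s)"
  shows "arc_deriv line_atlas \<gamma> f s = v"
proof -
  have "(SOME c. c \<in> line_atlas \<and> s \<in> fst c) = (UNIV, id)"
    by (rule some_equality) auto
  then show ?thesis
    using assms by (simp add: arc_deriv_def vector_derivative_at)
qed

text \<open>The global angle \<open>\<theta>\<close> is a witness. For uniqueness, any other local
  angle differs from it near \<open>s\<close> by a constant and so has the same derivative
  there.\<close>

lemma curvature_unit_speed:
  assumes \<gamma>: "\<And>s. (\<gamma> has_vector_derivative vector [cos (\<theta> s), sin (\<theta> s)]) (at s)"
    and \<theta>: "\<And>s. (\<theta> has_real_derivative \<kappa> s) (at s)"
  shows "curvature euclideanreal line_atlas \<gamma> = \<kappa>"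
proof
  fix s
  have unit: "norm (vector_derivative \<gamma> (at s)) = 1" for s
    by (simp add: vector_derivative_at[OF \<gamma>])
  have T: "unit_tangent line_atlas \<gamma> s = vector [cos (\<theta> s), sin (\<theta> s)]" for s
    unfolding unit_tangent_def by (rule arc_deriv_unit_speed[OF unit \<gamma>])
  have cont: "continuous_on A \<theta>" for A
    using DERIV_isCont[OF \<theta>] by (intro continuous_at_imp_continuous_on) auto
  show "curvature euclideanreal line_atlas \<gamma> s = \<kappa> s"
    unfolding curvature_def
  proof (rule the_equality)
    have "tangent_angle_on euclideanreal line_atlas \<gamma> UNIV \<theta>"
      by (simp add: tangent_angle_on_def T cont)
    moreover have "\<kappa> s = arc_deriv line_atlas \<gamma> \<theta> s"
      using \<theta> by (intro arc_deriv_unit_speed[symmetric] unit)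
        (simp add: has_real_derivative_iff_has_vector_derivative)
    ultimately show "\<exists>U \<theta>. openin euclideanreal U \<and> s \<in> U \<and>
        tangent_angle_on euclideanreal line_atlas \<gamma> U \<theta> \<and> \<kappa> s = arc_deriv line_atlas \<gamma> \<theta> s"
      by (intro exI[of _ UNIV] exI[of _ \<theta>]) auto
  next
    fix k
    assume "\<exists>U \<theta>. openin euclideanreal U \<and> s \<in> U \<and>
        tangent_angle_on euclideanreal line_atlas \<gamma> U \<theta> \<and> k = arc_deriv line_atlas \<gamma> \<theta> s"
    then obtain U \<phi> where U: "open U" "s \<in> U" and cont_\<phi>: "continuous_on U \<phi>"
      and \<phi>: "\<And>r. r \<in> U \<Longrightarrow> vector [cos (\<theta> r), sin (\<theta> r)] = (vector [cos (\<phi> r), sin (\<phi> r)] :: real^2)"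
      and k: "k = arc_deriv line_atlas \<gamma> \<phi> s"
      by (auto simp: tangent_angle_on_def T)
    define d where "d r = \<phi> r - \<theta> r" for r
    have eq: "cos (\<phi> r) = cos (\<theta> r)" "sin (\<phi> r) = sin (\<theta> r)" if "r \<in> U" for r
      using arg_cong[OF \<phi>[OF that], of "\<lambda>v. v $ 1"] arg_cong[OF \<phi>[OF that], of "\<lambda>v. v $ 2"] by simp_all
    have d_trig: "cos (d r) = 1" "sin (d r) = 0" if "r \<in> U" for r
      using eq[OF that] by (simp_all add: d_def cos_diff sin_diff flip: power2_eq_square)
    have "continuous_on U d"
      unfolding d_def by (intro continuous_intros cont_\<phi> cont)
    then have "isCont d s"
      using U by (simp add: continuous_on_eq_continuous_at)
    \<comment> \<open>The difference \<open>d\<close> takes values in the multiples of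
      \<open>2 * pi\<close>; staying within less than \<open>2 * pi\<close> of \<open>d s\<close>
      makes it constant near \<open>s\<close>.\<close>
    then have "eventually (\<lambda>r. dist (d r) (d s) < 2 * pi) (nhds s)"
      by (intro tendstoD) (simp_all add: isCont_def tendsto_at_iff_tendsto_nhds)
    moreover have "eventually (\<lambda>r. r \<in> U) (nhds s)"
      using U by (rule eventually_nhds_in_open)
    ultimately have "eventually (\<lambda>r. \<phi> r = \<theta> r + d s) (nhds s)"
    proof eventually_elim
      case (elim r)
      have "cos (d r - d s) = 1"
        using d_trig[OF elim(2)] d_trig[OF U(2)] by (simp add: cos_diff)
      then obtain n :: int where n: "d r - d s = n * 2 * pi"
        by (auto simp: cos_one_2pi_int)
      have "\<bar>real_of_int n\<bar> * (2 * pi) < 1 * (2 * pi)"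
        using elim(1) by (simp add: dist_real_def n abs_mult)
      then have "\<bar>real_of_int n\<bar> < 1"
        by (rule mult_right_less_imp_less) simp
      then have "n = 0" by linarith
      then show ?case using n by (simp add: d_def)
    qed
    then have "(\<phi> has_real_derivative \<kappa> s) (at s)"
      using DERIV_cong_ev[OF refl _ refl, of \<phi> "\<lambda>r. \<theta> r + d s" s "\<kappa> s"] \<theta>[of s]
      by (auto intro!: derivative_eq_intros)
    then show "k = \<kappa> s"
      unfolding k by (intro arc_deriv_unit_speed unit) (simp add: has_real_derivative_iff_has_vector_derivative)
  qed
qed

section \<open>Geometry, properness and motion of the profile curve\<close>

context angle_profile
begin

text \<open>Since \<open>y' = cos u\<close>, the derivative of the curvature itself serves as
  horizontal coordinate. The height \<open>g\<close> remains a parameter so that vertical translates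
  have the same form.\<close>

definition curve :: "(real \<Rightarrow> real) \<Rightarrow> real \<Rightarrow> real^2" where
  "curve g s = vector [y s, g s]"

context
  fixes g :: "real \<Rightarrow> real"
  assumes g': "\<And>s. (g has_real_derivative sin (u s)) (at s)"
begin

lemma curve': "(curve g has_vector_derivative vector [cos (u s), sin (u s)]) (at s)"
  unfolding curve_def by (rule has_vector_derivative_vector_2[OF y' g'])

lemma curve_unit_speed: "norm (vector_derivative (curve g) (at s)) = 1"
  by (simp add: vector_derivative_at[OF curve'])

lemma smooth_curve: "smooth_on S (curve g)"
proof -
  \<comment> \<open>The angle \<open>u\<close> enters only through its cosine and sine, whose
    derivatives are again products of these generators and constants.\<close>
  let ?B = "{p, y, g, \<lambda>s. cos (u s), \<lambda>s. sin (u s)}"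
  let ?A = "generated_algebra ?B"
  have 1: "(\<lambda>s. (- 1) * (sin (u s) * p s)) \<in> ?A" and 2: "(\<lambda>s. cos (u s) * p s) \<in> ?A"
    by (intro generated_algebra.mult generated_algebra.const generated_algebra.gen; simp)+
  have B: "\<exists>f'\<in>?A. \<forall>x. (f has_real_derivative f' x) (at x)" if "f \<in> ?B" for f
  proof -
    have "\<exists>f'\<in>?A. \<forall>x. (p has_real_derivative f' x) (at x)"
      using p' by (intro bexI[of _ y] generated_algebra.gen) auto
    moreover have "\<exists>f'\<in>?A. \<forall>x. (y has_real_derivative f' x) (at x)"
      using y' by (intro bexI[of _ "\<lambda>s. cos (u s)"] generated_algebra.gen) auto
    moreover have "\<exists>f'\<in>?A. \<forall>x. (g has_real_derivative f' x) (at x)"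
      using g' by (intro bexI[of _ "\<lambda>s. sin (u s)"] generated_algebra.gen) auto
    moreover have "\<exists>f'\<in>?A. \<forall>x. ((\<lambda>s. cos (u s)) has_real_derivative f' x) (at x)"
      by (rule bexI[OF _ 1]) (auto intro!: derivative_eq_intros u')
    moreover have "\<exists>f'\<in>?A. \<forall>x. ((\<lambda>s. sin (u s)) has_real_derivative f' x) (at x)"
      by (rule bexI[OF _ 2]) (auto intro!: derivative_eq_intros u')
    ultimately show ?thesis using that by blast
  qed
  show ?thesis
  proof (rule smooth_on_of_derivative_closed)
    show "curve g \<in> {\<lambda>s. vector [a s, b s] | a b. a \<in> ?A \<and> b \<in> ?A}"
      using generated_algebra.gen[of y ?B] generated_algebra.gen[of g ?B]
      by (intro CollectI exI[of _ y] exI[of _ g]) (simp add: curve_def fun_eq_iff)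
  next
    fix f :: "real \<Rightarrow> real^2"
    assume "f \<in> {\<lambda>s. vector [a s, b s] | a b. a \<in> ?A \<and> b \<in> ?A}"
    then obtain a b where f: "f = (\<lambda>s. vector [a s, b s])" "a \<in> ?A" "b \<in> ?A" by blast
    obtain a' b' where "a' \<in> ?A" "b' \<in> ?A"
      "\<forall>x. (a has_real_derivative a' x) (at x)" "\<forall>x. (b has_real_derivative b' x) (at x)"
      using generated_algebra_derivative[OF B f(2)] generated_algebra_derivative[OF B f(3)] by blast
    then show "\<exists>f'\<in>{\<lambda>s. vector [a s, b s] | a b. a \<in> ?A \<and> b \<in> ?A}.
        \<forall>x. (f has_vector_derivative f' x) (at x)"
      unfolding f(1)
      by (intro bexI[of _ "\<lambda>s. vector [a' s, b' s]"] allI has_vector_derivative_vector_2) blast+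
  qed
qed

lemma immersion_curve: "immersion line_atlas (curve g)"
proof -
  have "vector_derivative (curve g) (at s) \<noteq> 0" for s
    using curve_unit_speed[of s] by auto
  then show ?thesis
    by (simp add: immersion_def smooth_curve)
qed

lemma unit_normal_curve: "unit_normal line_atlas (curve g) s = vector [- sin (u s), cos (u s)]"
  by (simp add: unit_normal_def unit_tangent_def rot90_def
      arc_deriv_unit_speed[OF curve_unit_speed curve'])

lemma curvature_curve: "curvature euclideanreal line_atlas (curve g) = p"
  by (rule curvature_unit_speed[OF curve' u'])

lemma curvature_ss_curve: "curvature_ss euclideanreal line_atlas (curve g) s = cos (u s)"
proof -
  have "arc_deriv line_atlas (curve g) p = y"
    using p' by (intro ext arc_deriv_unit_speed curve_unit_speed)
      (simp add: has_real_derivative_iff_has_vector_derivative)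
  moreover have "arc_deriv line_atlas (curve g) y s = cos (u s)"
    using y' by (intro arc_deriv_unit_speed curve_unit_speed)
      (simp add: has_real_derivative_iff_has_vector_derivative)
  ultimately show ?thesis
    by (simp add: curvature_ss_def curvature_curve)
qed

lemma properly_immersed_curve:
  assumes H_le: "\<And>s. s \<ge> 0 \<Longrightarrow> H s \<le> 1"
  shows "properly_immersed euclideanreal line_atlas (curve g)"
proof -
  obtain c C where "c > 0" and g_le: "\<And>s. s \<ge> 0 \<Longrightarrow> g s \<le> C - c * s"
    using height_decreases_linearly[OF H_le g'] by blast
  \<comment> \<open>Evenness extends the descent on the positive half line to both ends, so a bound
    on the height bounds the parameter.\<close>
  have "g (- s) = g s" for s
    by (rule even_antiderivative_of_odd[OF g'])
      (simp add: angle_profile_odd[OF angle_profile_axioms])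
  then have g_abs: "c * \<bar>s\<bar> \<le> C - g s" for s
    using g_le[of "\<bar>s\<bar>"] by (auto simp: abs_if)
  have "compact {s. curve g s \<in> K}" if "compact K" for K
  proof -
    obtain B where B: "\<And>v. v \<in> K \<Longrightarrow> norm v \<le> B"
      using compact_imp_bounded[OF \<open>compact K\<close>] by (auto simp: bounded_iff)
    have "norm s \<le> (C + B) / c" if "curve g s \<in> K" for s
    proof -
      have "\<bar>g s\<bar> \<le> B"
        using B[OF that] component_le_norm_cart[of "curve g s" 2] by (simp add: curve_def)
      then have "c * \<bar>s\<bar> \<le> C + B" using g_abs[of s] by linarith
      then show ?thesis using \<open>c > 0\<close> by (simp add: field_simps)
    qed
    then have "bounded {s. curve g s \<in> K}" by (auto simp: bounded_iff)
    moreover have "closed {s. curve g s \<in> K}"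
      using continuous_closed_vimage[of K "curve g"] compact_imp_closed[OF \<open>compact K\<close>]
        has_vector_derivative_continuous[OF curve'] by (simp add: vimage_def)
    ultimately show ?thesis by (simp add: compact_eq_bounded_closed)
  qed
  then show ?thesis by (simp add: properly_immersed_def immersion_curve)
qed

text \<open>Constant \<open>p\<close> would give \<open>y = 0\<close>, hence
  \<open>cos (u 0) = 0\<close>, against \<open>u 0 = 0\<close>.\<close>

lemma curvature_nonconstant: "\<not> curvature euclideanreal line_atlas (curve g) constant_on UNIV"
proof
  assume "curvature euclideanreal line_atlas (curve g) constant_on UNIV"
  then obtain k where "p = (\<lambda>_. k)"
    by (auto simp: constant_on_def curvature_curve fun_eq_iff)
  then have y_eq: "y = (\<lambda>_. 0)"
    using DERIV_unique[OF p' DERIV_const[of k, folded \<open>p = (\<lambda>_. k)\<close>]] by auto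
  then have "cos (u 0) = 0"
    using DERIV_unique[OF y'[of 0], of 0] by (auto simp: y_eq u_0)
  then show False by (simp add: u_0)
qed

end

lemma translating_curve:
  assumes g': "\<And>s. (g has_real_derivative sin (u s)) (at s)"
  shows "translating_solution euclideanreal line_atlas UNIV (\<lambda>(s, t). curve g s + t *\<^sub>R vector [0, - 1])
    (vector [0, - 1]) (curve g)"
proof -
  let ?E = "vector [0, - 1] :: real^2"
  let ?X = "\<lambda>(s, t). curve g s + t *\<^sub>R ?E"
  \<comment> \<open>Each time slice is the curve with height \<open>g - t\<close>, still an
    antiderivative of \<open>sin u\<close>, so the geometric lemmas apply at every time.\<close>
  have slice: "(\<lambda>s. ?X (s, t)) = curve (\<lambda>s. g s - t)" for t
    by (simp add: curve_def fun_eq_iff vec_eq_iff forall_2)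
  have g't: "((\<lambda>s. g s - t) has_real_derivative sin (u s)) (at s)" for s t
    using g' by (auto intro!: derivative_eq_intros)
  have dt: "((\<lambda>\<tau>. ?X (s, \<tau>)) has_vector_derivative ?E) (at t)" for s t
    by (auto intro!: derivative_eq_intros)
  have norm_E: "norm ?E = 1"
    by (simp add: norm_eq_sqrt_inner inner_vec_def sum_2)
  have "normal_component line_atlas (\<lambda>s. ?X (s, t)) s ?E =
      - curvature_ss euclideanreal line_atlas (\<lambda>s. ?X (s, t)) s *\<^sub>R
        unit_normal line_atlas (\<lambda>s. ?X (s, t)) s" for s t
    \<comment> \<open>For the downward unit vector the inner product with the normal is
      \<open>- cos u\<close>, which is minus the second arc-length derivative of the
      curvature.\<close>
    unfolding slice normal_component_def curvature_ss_curve[OF g't] unit_normal_curve[OF g't]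
    by (simp add: inner_vec_def sum_2)
  moreover have "immersion line_atlas (\<lambda>s. ?X (s, t))" for t
    unfolding slice by (rule immersion_curve[OF g't])
  ultimately have "curve_diffusion_flow euclideanreal line_atlas UNIV ?X"
    unfolding curve_diffusion_flow_def using dt
    by (intro conjI ballI exI[of _ ?E] oriented_1_manifold_line) auto
  then show ?thesis
    using norm_E dt by (simp add: translating_solution_def)
qed

end

theorem theorem1p1:
  shows "\<exists>(M :: real topology) (A :: real chart set) (I :: real set)
            (X :: real \<times> real \<Rightarrow> real^2) (E :: real^2) (\<gamma> :: real \<Rightarrow> real^2).
           translating_solution M A I X E \<gamma> \<and>
           properly_immersed M A \<gamma> \<and>
           \<not> curvature M A \<gamma> constant_on topspace M"
proof -
  obtain u p y where "angle_profile u p y" and H_le: "\<And>s. s \<ge> 0 \<Longrightarrow> angle_profile.H u p y s \<le> 1"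
    using bounded_H_profile_exists by blast
  then interpret angle_profile u p y by simp
  have "continuous_on UNIV (\<lambda>s. sin (u s))"
    using DERIV_isCont[OF u'] by (intro continuous_intros continuous_at_imp_continuous_on) auto
  then obtain g where g: "\<And>s. (g has_real_derivative sin (u s)) (at s)"
    using antiderivative_real_line[of "\<lambda>s. sin (u s)" 0]
    by (auto simp: has_real_derivative_iff_has_vector_derivative)
  show ?thesis
    using translating_curve[OF g] properly_immersed_curve[OF g H_le] curvature_nonconstant[OF g]
    by (intro exI[of _ euclideanreal] exI[of _ line_atlas] exI[of _ UNIV]
        exI[of _ "\<lambda>(s, t). curve g s + t *\<^sub>R vector [0, - 1]"]
        exI[of _ "vector [0, - 1]"] exI[of _ "curve g"] conjI) simp_all
qed

end
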